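(* Let $n\ge 1$, let $\mathcal{L} \subset \mathbb{R}^{2n}$ be a Lagrangian subspace and $\mathbf{B} = (x_1, \ldots , x_n)$ any ordered basis of $\mathcal{L}$. Let $X_L^{\bot} \in \mathbb{R}^{2n \times (n+1)}$ be a matrix whose columns are an orthonormal basis of the (Euclidean) orthogonal complement $\textnormal{span} \lbrace x_1, \ldots , x_{n-1} \rbrace^{\bot}$. Let $X_L = [\,x_1 \; \cdots \; x_{n-1}\,]$, $X_R = [\,x_2 \; \cdots \; x_n\,]$ in $\mathbb{R}^{2n\times(n-1)}$ and let $\widehat{H} := X_RX_L^+ + J_{2n}^T(X_RX_L^+)^TJ_{2n}\in \mathbb{R}^{2n \times 2n}$. Then a matrix $H\in\mathbb{R}^{2n\times 2n}$ satisfies $H \in \mathbb{HK}(\mathbf{B})$ if and only if it can be expressed as $$H = \widehat{H} + J_{2n}^TX_L^{\bot} S (X_L^{\bot})^T$$ where $S \in \mathbb{R}^{(n+1) \times (n+1)}$ is some skew-symmetric matrix.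
   Context: $J_{2n} = \begin{bmatrix} 0 & I_n \\ -I_n & 0 \end{bmatrix} \in \mathbb{R}^{2n\times 2n}$. A subspace $\mathcal{L}\subset\mathbb{R}^{2n}$ is called isotropic if $x^TJ_{2n}y = 0$ for all $x,y\in\mathcal{L}$, and Lagrangian if it is isotropic and of dimension $n$. A matrix $H\in\mathbb{R}^{2n\times 2n}$ is called skew-Hamiltonian if $J_{2n}^TH^TJ_{2n} = H$. For an ordered basis $\mathbf{B}=(x_1,\ldots,x_n)$ of a Lagrangian subspace, $\mathbb{HK}(\mathbf{B})$ denotes the set of all skew-Hamiltonian matrices $H\in\mathbb{R}^{2n\times 2n}$ satisfying $Hx_k = x_{k+1}$ for all $k=1,\ldots,n-1$. $A^+$ denotes the Moore-Penrose pseudoinverse of $A$. (For $n=1$ the matrices $X_L,X_R$ have no columns and $X_RX_L^+$ is the zero matrix.) *)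

theory Defs
  imports "Jordan_Normal_Form.VS_Connect"
begin

abbreviation rvec_space :: "nat \<Rightarrow> (real, real vec) module" where
  "rvec_space m \<equiv> module_vec TYPE(real) m"

definition rsubspace :: "nat \<Rightarrow> real vec set \<Rightarrow> bool" where
  "rsubspace m W \<longleftrightarrow> VectorSpace.subspace class_ring W (rvec_space m)"

definition rdim :: "nat \<Rightarrow> real vec set \<Rightarrow> nat" where
  "rdim m W = vectorspace.dim class_ring ((rvec_space m)\<lparr>carrier := W\<rparr>)"

text \<open>The library's notion of basis is for sets; an ordered basis is a list without
  repetitions whose underlying set is a basis.\<close>

definition ordered_basis :: "nat \<Rightarrow> real vec set \<Rightarrow> real vec list \<Rightarrow> bool" where
  "ordered_basis m W vs \<longleftrightarrow>
     distinct vs \<and> vectorspace.basis class_ring ((rvec_space m)\<lparr>carrier := W\<rparr>) (set vs)"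

definition rspan :: "nat \<Rightarrow> real vec set \<Rightarrow> real vec set" where
  "rspan m A = LinearCombinations.module.span class_ring (rvec_space m) A"

definition orth_compl :: "nat \<Rightarrow> real vec set \<Rightarrow> real vec set" where
  "orth_compl m W = vec_module.orthogonal_complement m W"

definition orthonormal :: "real vec list \<Rightarrow> bool" where
  "orthonormal vs \<longleftrightarrow>
     (\<forall>i < length vs. \<forall>j < length vs. vs ! i \<bullet> vs ! j = (if i = j then 1 else 0))"

definition J_mat :: "nat \<Rightarrow> real mat" where
  "J_mat n = four_block_mat (0\<^sub>m n n) (1\<^sub>m n) (- 1\<^sub>m n) (0\<^sub>m n n)"

definition isotropic :: "nat \<Rightarrow> real vec set \<Rightarrow> bool" where
  "isotropic n L \<longleftrightarrow> rsubspace (2 * n) L \<and> (\<forall>x \<in> L. \<forall>y \<in> L. x \<bullet> (J_mat n *\<^sub>v y) = 0)"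

definition lagrangian :: "nat \<Rightarrow> real vec set \<Rightarrow> bool" where
  "lagrangian n L \<longleftrightarrow> isotropic n L \<and> rdim (2 * n) L = n"

definition skew_hamiltonian :: "nat \<Rightarrow> real mat \<Rightarrow> bool" where
  "skew_hamiltonian n H \<longleftrightarrow>
     H \<in> carrier_mat (2 * n) (2 * n) \<and>
     transpose_mat (J_mat n) * transpose_mat H * J_mat n = H"

definition skew_symmetric :: "nat \<Rightarrow> real mat \<Rightarrow> bool" where
  "skew_symmetric m S \<longleftrightarrow> S \<in> carrier_mat m m \<and> transpose_mat S = - S"

text \<open>Lists are indexed from 0, so that \<open>xs ! k\<close> is the basis vector $x_{k+1}$.\<close>

definition HK :: "nat \<Rightarrow> real vec list \<Rightarrow> real mat set" where
  "HK n xs = {H. skew_hamiltonian n H \<and> (\<forall>k < n - 1. H *\<^sub>v (xs ! k) = xs ! (k + 1))}"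

text \<open>The Moore-Penrose pseudoinverse, characterised by the four Penrose equations.\<close>

definition is_pinv :: "real mat \<Rightarrow> real mat \<Rightarrow> bool" where
  "is_pinv A X \<longleftrightarrow>
     X \<in> carrier_mat (dim_col A) (dim_row A) \<and>
     A * X * A = A \<and> X * A * X = X \<and>
     transpose_mat (A * X) = A * X \<and> transpose_mat (X * A) = X * A"

definition pinv :: "real mat \<Rightarrow> real mat" where
  "pinv A = (THE X. is_pinv A X)"

lemma is_pinv_unique:
  assumes X: "is_pinv A X" and Y: "is_pinv A Y"
  shows "X = Y"
proof -
  define r c where "r = dim_row A" and "c = dim_col A"
  have A: "A \<in> carrier_mat r c" unfolding r_def c_def by simp
  have cX: "X \<in> carrier_mat c r" and cY: "Y \<in> carrier_mat c r"
    using X Y unfolding is_pinv_def r_def c_def by auto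
  note X' = X[unfolded is_pinv_def] and Y' = Y[unfolded is_pinv_def]
  have asm: "P * Q * R = P * (Q * R)"
    if "dim_col P = dim_row Q" "dim_col Q = dim_row R" for P Q R :: "real mat"
    using that by (intro assoc_mult_mat) auto
  have dims: "dim_row A = r" "dim_col A = c" "dim_row X = c" "dim_col X = r"
    "dim_row Y = c" "dim_col Y = r" using A cX cY by auto
  have AX: "A * X = A * Y"
  proof -
    have "A * X = transpose_mat (A * Y * A * X)" using X' Y' by simp
    also have "\<dots> = transpose_mat ((A * Y) * (A * X))"
      by (simp add: asm dims)
    also have "\<dots> = transpose_mat (A * X) * transpose_mat (A * Y)"
      using A cX cY by (intro transpose_mult[of _ r r _ r]) auto
    also have "\<dots> = (A * X) * (A * Y)" using X' Y' by simp
    also have "\<dots> = A * X * A * Y"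
      by (simp add: asm dims)
    also have "\<dots> = A * Y" using X' by simp
    finally show ?thesis .
  qed
  have XA: "X * A = Y * A"
  proof -
    have "X * A = X * (A * Y * A)" using Y' by simp
    also have "\<dots> = (X * A) * (Y * A)"
      by (simp add: asm dims)
    also have "\<dots> = transpose_mat (X * A) * transpose_mat (Y * A)" using X' Y' by simp
    also have "\<dots> = transpose_mat ((Y * A) * (X * A))"
      using A cX cY by (intro transpose_mult[symmetric, of _ c c _ c]) auto
    also have "(Y * A) * (X * A) = Y * (A * X * A)"
      by (simp add: asm dims)
    also have "\<dots> = Y * A" using X' by simp
    finally show ?thesis using Y' by simp
  qed
  have "X = X * A * X" using X' by simp
  also have "\<dots> = Y * A * X" using XA by simp
  also have "\<dots> = Y * (A * X)" using A cX cY by (intro assoc_mult_mat[of _ c r _ c _ r]) auto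
  also have "\<dots> = Y * (A * Y)" using AX by simp
  also have "\<dots> = Y * A * Y" using A cX cY by (intro assoc_mult_mat[symmetric, of _ c r _ c _ r]) auto
  also have "\<dots> = Y" using Y' by simp
  finally show ?thesis .
qed

lemma pinv_eqI: "is_pinv A X \<Longrightarrow> pinv A = X"
  unfolding pinv_def using is_pinv_unique by blast

definition X_left :: "nat \<Rightarrow> real vec list \<Rightarrow> real mat" where
  "X_left n xs = mat_of_cols (2 * n) (butlast xs)"

definition X_right :: "nat \<Rightarrow> real vec list \<Rightarrow> real mat" where
  "X_right n xs = mat_of_cols (2 * n) (tl xs)"

definition H_hat :: "nat \<Rightarrow> real vec list \<Rightarrow> real mat" where
  "H_hat n xs =
     X_right n xs * pinv (X_left n xs)
     + transpose_mat (J_mat n) * transpose_mat (X_right n xs * pinv (X_left n xs)) * J_mat n"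

end

theory Submission
  imports Defs "Jordan_Normal_Form.DL_Rank"
begin

text \<open>
  $H$ is skew-Hamiltonian iff $JH$ is skew-symmetric, and membership in the set in question means
  moreover $H X_L = X_R$. Since $X_L$ has full column rank, $X_L^+ X_L = I$, and isotropy
  ($X_R^T J X_L = 0$) makes $\widehat H$ a particular solution. The difference $D$ of two solutions
  yields a skew-symmetric $M = JD$ with $M X_L = 0$; from $X_L X_L^+ + P P^T = I$ for
  $P = X_L^\bot$ one obtains $M = P (P^T M P) P^T$, so $S = P^T M P$.
\<close>

section \<open>Matrix products and complementary blocks\<close>

lemma mult_mat_assoc_dims:
  fixes A B C :: "'a::semiring_0 mat"
  assumes "dim_col A = dim_row B" "dim_col B = dim_row C"
  shows "A * B * C = A * (B * C)"
  using assms by (intro assoc_mult_mat) auto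

lemma transpose_mult_dims:
  fixes A B :: "'a::comm_semiring_0 mat"
  assumes "dim_col A = dim_row B"
  shows "(A * B)\<^sup>T = B\<^sup>T * A\<^sup>T"
  using assms by (intro transpose_mult) auto

text \<open>The hypotheses say that stacking $C$ over $D$ gives a left inverse of the square block matrix
  $[A\; B]$; it is then also a right inverse.\<close>

lemma sum_complementary_products_eq_one:
  fixes A B C D :: "'a::field mat"
  assumes A: "A \<in> carrier_mat (k + p) k" and B: "B \<in> carrier_mat (k + p) p"
    and C: "C \<in> carrier_mat k (k + p)" and D: "D \<in> carrier_mat p (k + p)"
    and CA: "C * A = 1\<^sub>m k" and CB: "C * B = 0\<^sub>m k p"
    and DA: "D * A = 0\<^sub>m p k" and DB: "D * B = 1\<^sub>m p"
  shows "A * C + B * D = 1\<^sub>m (k + p)"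
proof -
  \<comment> \<open>Blocks with no rows or no columns pad the block form: \<open>Q\<close> is
    \<open>A\<close> beside \<open>B\<close>, and \<open>W\<close> is \<open>C\<close> above
    \<open>D\<close>. In \<open>Q * W\<close> only the upper left block is nonempty.\<close>
  define Q where "Q = four_block_mat A B (0\<^sub>m 0 k) (0\<^sub>m 0 p)"
  define W where "W = four_block_mat C (0\<^sub>m k 0) D (0\<^sub>m p 0)"
  have Q: "Q \<in> carrier_mat (k + p) (k + p)"
    using four_block_carrier_mat[OF A, of "0\<^sub>m 0 p" 0 p "B" "0\<^sub>m 0 k"] unfolding Q_def by simp
  have W: "W \<in> carrier_mat (k + p) (k + p)"
    using four_block_carrier_mat[OF C, of "0\<^sub>m p 0" p 0 "0\<^sub>m k 0" D] unfolding W_def by simp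
  have "W * Q = four_block_mat (C * A + 0\<^sub>m k 0 * 0\<^sub>m 0 k) (C * B + 0\<^sub>m k 0 * 0\<^sub>m 0 p)
      (D * A + 0\<^sub>m p 0 * 0\<^sub>m 0 k) (D * B + 0\<^sub>m p 0 * 0\<^sub>m 0 p)"
    unfolding W_def Q_def by (rule mult_four_block_mat[OF C _ D _ A B]) auto
  also have "\<dots> = four_block_mat (1\<^sub>m k) (0\<^sub>m k p) (0\<^sub>m p k) (1\<^sub>m p)"
    by (simp add: CA CB DA DB)
  also have "\<dots> = 1\<^sub>m (k + p)" by simp
  finally have "Q * W = 1\<^sub>m (k + p)" by (rule mat_mult_left_right_inverse[OF W Q])
  moreover have "Q * W = four_block_mat (A * C + B * D) (A * 0\<^sub>m k 0 + B * 0\<^sub>m p 0)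
      (0\<^sub>m 0 k * C + 0\<^sub>m 0 p * D) (0\<^sub>m 0 k * 0\<^sub>m k 0 + 0\<^sub>m 0 p * 0\<^sub>m p 0)"
    unfolding W_def Q_def by (rule mult_four_block_mat[OF A B _ _ C _ D]) auto
  moreover have "four_block_mat (A * C + B * D) (A * 0\<^sub>m k 0 + B * 0\<^sub>m p 0)
      (0\<^sub>m 0 k * C + 0\<^sub>m 0 p * D) (0\<^sub>m 0 k * 0\<^sub>m k 0 + 0\<^sub>m 0 p * 0\<^sub>m p 0) = A * C + B * D"
    using A B C D by (intro eq_matI) auto
  ultimately show ?thesis by simp
qed

section \<open>Pseudoinverse of a matrix with full column rank\<close>

lemma scalar_prod_self_eq_0:
  fixes v :: "real vec"
  assumes "v \<in> carrier_vec m" "v \<bullet> v = 0"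
  shows "v = 0\<^sub>v m"
  using assms by (intro eq_vecI) (auto simp: scalar_prod_def sum_nonneg_eq_0_iff)

text \<open>Injectivity makes the Gram matrix \<open>F\<close> of the columns invertible, and its
  inverse \<open>G\<close> yields a solution of the Penrose equations. The factor
  \<open>A\<^sup>T\<close> is kept visible because it shows that \<open>pinv A\<close> kills every
  vector orthogonal to the columns of \<open>A\<close>.\<close>

lemma pinv_full_column_rank:
  fixes A :: "real mat"
  assumes A: "A \<in> carrier_mat m k"
    and inj: "\<And>v. v \<in> carrier_vec k \<Longrightarrow> A *\<^sub>v v = 0\<^sub>v m \<Longrightarrow> v = 0\<^sub>v k"
  obtains G where "G \<in> carrier_mat k k" "pinv A = G * A\<^sup>T" "pinv A * A = 1\<^sub>m k"
proof -
  have dA: "dim_row A = m" "dim_col A = k" using A by auto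
  define F where "F = A\<^sup>T * A"
  have F: "F \<in> carrier_mat k k" using A unfolding F_def by auto
  have "det F \<noteq> 0"
  proof
    assume "det F = 0"
    then obtain v where v: "v \<in> carrier_vec k" "v \<noteq> 0\<^sub>v k" "F *\<^sub>v v = 0\<^sub>v k"
      unfolding det_0_iff_vec_prod_zero[OF F] by auto
    have Av: "A *\<^sub>v v \<in> carrier_vec m" using A v by auto
    \<comment> \<open>Moving \<open>A\<close> across the product turns the squared norm of
      \<open>A v\<close> into the pairing of \<open>F v = 0\<close> with \<open>v\<close>.\<close>
    have "(A *\<^sub>v v) \<bullet> (A *\<^sub>v v) = (A\<^sup>T *\<^sub>v (A *\<^sub>v v)) \<bullet> v"
      using transpose_vec_mult_scalar[OF A v(1) Av] Av v A
      by (simp add: comm_scalar_prod[of v k])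
    also have "A\<^sup>T *\<^sub>v (A *\<^sub>v v) = 0\<^sub>v k"
      using v A unfolding F_def by (simp add: assoc_mult_mat_vec[of _ k m _ k])
    finally have "A *\<^sub>v v = 0\<^sub>v m"
      using scalar_prod_self_eq_0[OF Av] v by simp
    with inj v show False by auto
  qed
  from det_non_zero_imp_unit[OF F this, of "()"] obtain G
    where G: "G \<in> carrier_mat k k" and GF: "G * F = 1\<^sub>m k" and FG: "F * G = 1\<^sub>m k"
    unfolding Units_def ring_mat_def by auto
  have dG: "dim_row G = k" "dim_col G = k" and dF: "dim_row F = k" "dim_col F = k"
    using G F by auto
  have F_sym: "F\<^sup>T = F" unfolding F_def by (simp add: transpose_mult_dims)
  \<comment> \<open>As \<open>F\<close> is symmetric, the transpose of \<open>G\<close> is again a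
    left inverse of \<open>F\<close> and so equals \<open>G\<close>. This symmetry gives the third
    Penrose equation.\<close>
  have "G\<^sup>T * F = (F * G)\<^sup>T" by (simp add: transpose_mult_dims dG dF F_sym)
  then have GtF: "G\<^sup>T * F = 1\<^sub>m k" using FG by simp
  have "G\<^sup>T = G\<^sup>T * (F * G)" using G by (simp add: FG)
  also have "\<dots> = G" using G GtF by (simp add: mult_mat_assoc_dims[symmetric] dG dF)
  finally have G_sym: "G\<^sup>T = G" .
  have left_inv: "G * A\<^sup>T * A = 1\<^sub>m k"
    using GF unfolding F_def by (simp add: mult_mat_assoc_dims dG dA)
  have "is_pinv A (G * A\<^sup>T)"
    unfolding is_pinv_def
  proof (intro conjI)
    show "G * A\<^sup>T \<in> carrier_mat (dim_col A) (dim_row A)" using A G by auto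
    show "A * (G * A\<^sup>T) * A = A"
      using left_inv A by (simp add: mult_mat_assoc_dims dG dA)
    show "G * A\<^sup>T * A * (G * A\<^sup>T) = G * A\<^sup>T"
      using left_inv A G by simp
    show "(A * (G * A\<^sup>T))\<^sup>T = A * (G * A\<^sup>T)"
      by (simp add: transpose_mult_dims mult_mat_assoc_dims dG dA G_sym)
    show "(G * A\<^sup>T * A)\<^sup>T = G * A\<^sup>T * A" using left_inv by simp
  qed
  then have "pinv A = G * A\<^sup>T" by (rule pinv_eqI)
  with G left_inv show thesis by (intro that[of G]) auto
qed

section \<open>Subspaces, ordered bases and orthogonal complements\<close>

lemma rsubspace_vectorspace:
  assumes "rsubspace m W"
  shows "vectorspace class_ring ((rvec_space m)\<lparr>carrier := W\<rparr>)" "W \<subseteq> carrier_vec m"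
proof -
  interpret vec_space "TYPE(real)" m .
  show "vectorspace class_ring ((rvec_space m)\<lparr>carrier := W\<rparr>)"
    using assms unfolding rsubspace_def by (rule subspace_is_vs)
  show "W \<subseteq> carrier_vec m"
    using assms unfolding rsubspace_def VectorSpace.subspace_def submodule_def
    by (auto simp: module_vec_def)
qed

lemma ordered_basis_subset:
  assumes "rsubspace m W" "ordered_basis m W vs"
  shows "set vs \<subseteq> W"
  using assms(2) vectorspace.basis_def[OF rsubspace_vectorspace(1)[OF assms(1)]]
  unfolding ordered_basis_def by auto

text \<open>A nonzero kernel vector would be a linear dependence among columns taken from a basis.
  This is the source of the full column rank of X_L.\<close>

lemma ordered_basis_mult_vec_eq_0:
  assumes W: "rsubspace m W" and vs: "ordered_basis m W vs"
    and us: "set us \<subseteq> set vs" "distinct us"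
    and v: "v \<in> carrier_vec (length us)" "mat_of_cols m us *\<^sub>v v = 0\<^sub>v m"
  shows "v = 0\<^sub>v (length us)"
proof (rule ccontr)
  interpret vec_space "TYPE(real)" m .
  assume "v \<noteq> 0\<^sub>v (length us)"
  have sub: "set vs \<subseteq> W" by (rule ordered_basis_subset[OF W vs])
  have cols: "cols (mat_of_cols m us) = us"
    using us sub rsubspace_vectorspace(2)[OF W] by (intro cols_mat_of_cols) auto
  \<comment> \<open>Dependence concerns the set of columns; since \<open>us\<close> is distinct,
    coefficients of equal columns cannot merge and cancel.\<close>
  have "lin_dep (set us)"
    using lin_depI[of "mat_of_cols m us" "length us" v] v us(2) \<open>v \<noteq> _\<close>
    unfolding cols by auto
  moreover have "\<not> LinearCombinations.module.lin_dep class_ring ((rvec_space m)\<lparr>carrier := W\<rparr>) (set vs)"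
    using vs vectorspace.basis_def[OF rsubspace_vectorspace(1)[OF W]]
    unfolding ordered_basis_def by auto
  \<comment> \<open>Independence is passed from the space with carrier \<open>W\<close> to the
    ambient space, where the dependence lives.\<close>
  then have "lin_indpt (set vs)"
    using span_li_not_depend(2)[OF sub] W
    unfolding rsubspace_def VectorSpace.subspace_def by auto
  then have "lin_indpt (set us)" using us(1) subset_li_is_li by blast
  ultimately show False by simp
qed

text \<open>Facts about ordered bases presuppose a subspace; this makes them applicable to the
  columns of \<open>Xperp\<close>.\<close>

lemma rsubspace_orth_compl:
  assumes "W \<subseteq> carrier_vec m"
  shows "rsubspace m (orth_compl m W)"
proof -
  interpret vec_space "TYPE(real)" m .
  have "LinearCombinations.submodule class_ring (orthogonal_complement W) (rvec_space m)"
    unfolding LinearCombinations.submodule_def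
    using assms module_axioms
    by (auto simp: orthogonal_complement_def add_scalar_prod_distrib[of _ m]
         module_vec_def subset_iff)
  then show ?thesis
    unfolding rsubspace_def orth_compl_def VectorSpace.subspace_def
    using vectorspace_axioms by auto
qed

text \<open>By linearity of the scalar product, orthogonality to a span can be tested on
  generators.\<close>

lemma orth_compl_rspan:
  assumes "A \<subseteq> carrier_vec m"
  shows "orth_compl m (rspan m A) = {x \<in> carrier_vec m. \<forall>y\<in>A. x \<bullet> y = 0}"
    and "rspan m A \<subseteq> carrier_vec m"
proof -
  interpret vec_space "TYPE(real)" m .
  show "orth_compl m (rspan m A) = {x \<in> carrier_vec m. \<forall>y\<in>A. x \<bullet> y = 0}"
    unfolding orth_compl_def rspan_def in_orthogonal_complement_span[OF assms]
    by (simp add: orthogonal_complement_def)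
  show "rspan m A \<subseteq> carrier_vec m"
    unfolding rspan_def using span_is_subset2[of A] assms by (auto simp: module_vec_simps)
qed

section \<open>The matrix J and skew-Hamiltonian matrices\<close>

lemma J_mat_carrier [simp]: "J_mat n \<in> carrier_mat (2 * n) (2 * n)"
  unfolding J_mat_def using four_block_carrier_mat[of "0\<^sub>m n n" n n "0\<^sub>m n n" n n] by (simp add: mult_2)

lemma J_mat_dims [simp]: "dim_row (J_mat n) = 2 * n" "dim_col (J_mat n) = 2 * n"
  by (rule carrier_matD[OF J_mat_carrier])+

lemma transpose_J_mat: "(J_mat n)\<^sup>T = - J_mat n"
  by (intro eq_matI) (auto simp: J_mat_def)

lemma J_mat_square: "J_mat n * J_mat n = - 1\<^sub>m (2 * n)"
proof -
  have "J_mat n * J_mat n = four_block_mat (0\<^sub>m n n * 0\<^sub>m n n + 1\<^sub>m n * - 1\<^sub>m n)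
      (0\<^sub>m n n * 1\<^sub>m n + 1\<^sub>m n * 0\<^sub>m n n) (- 1\<^sub>m n * 0\<^sub>m n n + 0\<^sub>m n n * - 1\<^sub>m n)
      (- 1\<^sub>m n * 1\<^sub>m n + 0\<^sub>m n n * 0\<^sub>m n n)"
    unfolding J_mat_def by (rule mult_four_block_mat) auto
  also have "\<dots> = - 1\<^sub>m (2 * n)" by (intro eq_matI) auto
  finally show ?thesis .
qed

text \<open>The right-nested form fits products normalized by
  \<open>mult_mat_assoc_dims\<close>.\<close>

lemma J_mat_mult_J_mat_mult:
  assumes "dim_row A = 2 * n"
  shows "J_mat n * (J_mat n * A) = - A"
proof -
  have "J_mat n * (J_mat n * A) = J_mat n * J_mat n * A"
    by (simp add: mult_mat_assoc_dims assms)
  then show ?thesis using assms by (simp add: J_mat_square)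
qed


text \<open>The inverse of J is its transpose, which is -J. Multiplying the defining equation by J
  turns it into \<open>H\<^sup>T * J_mat n = J_mat n * H\<close>, and the left side is minus the
  transpose of \<open>J_mat n * H\<close>.\<close>

lemma skew_hamiltonian_iff:
  assumes H: "H \<in> carrier_mat (2 * n) (2 * n)"
  shows "skew_hamiltonian n H \<longleftrightarrow> (J_mat n * H)\<^sup>T = - (J_mat n * H)"
proof -
  have d [simp]: "dim_row H = 2 * n" "dim_col H = 2 * n" using H by auto
  have JH: "(J_mat n * H)\<^sup>T = - (H\<^sup>T * J_mat n)"
    by (simp add: transpose_mult_dims transpose_J_mat)
  have eq: "(J_mat n)\<^sup>T * H\<^sup>T * J_mat n = - (J_mat n * (H\<^sup>T * J_mat n))"
    by (simp add: transpose_J_mat mult_mat_assoc_dims)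
  have "- (J_mat n * (H\<^sup>T * J_mat n)) = H \<longleftrightarrow> H\<^sup>T * J_mat n = J_mat n * H"
  proof
    assume "- (J_mat n * (H\<^sup>T * J_mat n)) = H"
    then have "J_mat n * H = J_mat n * - (J_mat n * (H\<^sup>T * J_mat n))" by simp
    also have "\<dots> = H\<^sup>T * J_mat n" by (simp add: J_mat_mult_J_mat_mult)
    finally show "H\<^sup>T * J_mat n = J_mat n * H" ..
  next
    assume "H\<^sup>T * J_mat n = J_mat n * H"
    then show "- (J_mat n * (H\<^sup>T * J_mat n)) = H" by (simp add: J_mat_mult_J_mat_mult)
  qed
  then show ?thesis using H by (simp add: skew_hamiltonian_def eq JH)
qed

lemma skew_hamiltonian_add:
  assumes "skew_hamiltonian n A" "skew_hamiltonian n B"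
  shows "skew_hamiltonian n (A + B)"
proof -
  have c: "A \<in> carrier_mat (2 * n) (2 * n)" "B \<in> carrier_mat (2 * n) (2 * n)"
    using assms unfolding skew_hamiltonian_def by auto
  have "J_mat n * (A + B) = J_mat n * A + J_mat n * B"
    by (rule mult_add_distrib_mat[OF J_mat_carrier c])
  moreover have d: "J_mat n * A \<in> carrier_mat (2 * n) (2 * n)"
    "J_mat n * B \<in> carrier_mat (2 * n) (2 * n)"
    using c by (auto intro: mult_carrier_mat[OF J_mat_carrier])
  have "- (J_mat n * A) + - (J_mat n * B) = - (J_mat n * A + J_mat n * B)"
    using c by (intro eq_matI) auto
  ultimately show ?thesis
    using assms c by (simp add: skew_hamiltonian_iff transpose_add[OF d])
qed

lemma skew_hamiltonian_uminus:
  assumes "skew_hamiltonian n A"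
  shows "skew_hamiltonian n (- A)"
proof -
  have c: "A \<in> carrier_mat (2 * n) (2 * n)"
    using assms unfolding skew_hamiltonian_def by auto
  then show ?thesis
    using assms by (simp add: skew_hamiltonian_iff transpose_uminus)
qed

text \<open>Multiplication by J turns the sum into JK minus its transpose, twice the skew-symmetric
  part of JK. The matrix \<open>H_hat n xs\<close> has this shape.\<close>

lemma skew_hamiltonian_symmetrization:
  assumes K: "K \<in> carrier_mat (2 * n) (2 * n)"
  shows "skew_hamiltonian n (K + (J_mat n)\<^sup>T * K\<^sup>T * J_mat n)"
proof -
  have d [simp]: "dim_row K = 2 * n" "dim_col K = 2 * n" using K by auto
  let ?J = "J_mat n"
  have c: "?J * K \<in> carrier_mat (2 * n) (2 * n)" "K\<^sup>T * ?J \<in> carrier_mat (2 * n) (2 * n)"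
    by (auto intro!: carrier_matI)
  have "?J * (K + ?J\<^sup>T * K\<^sup>T * ?J) = ?J * K + ?J * (?J\<^sup>T * K\<^sup>T * ?J)"
    by (rule mult_add_distrib_mat[OF J_mat_carrier K]) (auto intro!: carrier_matI)
  also have "?J * (?J\<^sup>T * K\<^sup>T * ?J) = K\<^sup>T * ?J"
    by (simp add: transpose_J_mat mult_mat_assoc_dims J_mat_mult_J_mat_mult)
  finally have eq: "?J * (K + ?J\<^sup>T * K\<^sup>T * ?J) = ?J * K + K\<^sup>T * ?J" .
  have "(?J * K + K\<^sup>T * ?J)\<^sup>T = - (K\<^sup>T * ?J) + - (?J * K)"
    by (simp add: transpose_add[OF c] transpose_mult_dims transpose_J_mat)
  also have "\<dots> = - (?J * K + K\<^sup>T * ?J)"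
    using c by (intro eq_matI) auto
  finally show ?thesis
    by (subst skew_hamiltonian_iff) (auto intro!: carrier_matI simp: eq)
qed

text \<open>Multiplication by J cancels its transpose and leaves \<open>P * (S * P\<^sup>T)\<close>,
  which inherits skew-symmetry from \<open>S\<close>.\<close>

lemma skew_hamiltonian_J_mat_sandwich:
  assumes P: "P \<in> carrier_mat (2 * n) m" and S: "skew_symmetric m S"
  shows "skew_hamiltonian n ((J_mat n)\<^sup>T * P * S * P\<^sup>T)"
proof -
  have d [simp]: "dim_row P = 2 * n" "dim_col P = m" "dim_row S = m" "dim_col S = m"
    using P S unfolding skew_symmetric_def by auto
  have "J_mat n * ((J_mat n)\<^sup>T * P * S * P\<^sup>T) = P * (S * P\<^sup>T)"
    by (simp add: transpose_J_mat mult_mat_assoc_dims J_mat_mult_J_mat_mult)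
  moreover have "(P * (S * P\<^sup>T))\<^sup>T = - (P * (S * P\<^sup>T))"
    using S by (simp add: transpose_mult_dims mult_mat_assoc_dims skew_symmetric_def)
  ultimately show ?thesis
    by (subst skew_hamiltonian_iff) (auto intro!: carrier_matI)
qed

text \<open>Multiplying the resolution \<open>one\<close> of the identity by JD on the left removes
  the part \<open>A * N\<close>; transposition gives the same on the other side. Thus JD lives on
  the columns of \<open>P\<close> alone. The lemma is meant for the difference of two
  solutions.\<close>

lemma skew_hamiltonian_annihilating:
  assumes D: "skew_hamiltonian n D"
    and A: "A \<in> carrier_mat (2 * n) k" and N: "N \<in> carrier_mat k (2 * n)"
    and P: "P \<in> carrier_mat (2 * n) m"
    and one: "A * N + P * P\<^sup>T = 1\<^sub>m (2 * n)" and DA: "D * A = 0\<^sub>m (2 * n) k"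
  obtains S where "skew_symmetric m S" "D = (J_mat n)\<^sup>T * P * S * P\<^sup>T"
proof -
  have cD: "D \<in> carrier_mat (2 * n) (2 * n)" using D unfolding skew_hamiltonian_def by simp
  define M where "M = J_mat n * D"
  have d [simp]: "dim_row D = 2 * n" "dim_col D = 2 * n" "dim_row A = 2 * n" "dim_col A = k"
    "dim_row N = k" "dim_col N = 2 * n" "dim_row P = 2 * n" "dim_col P = m"
    "dim_row M = 2 * n" "dim_col M = 2 * n"
    using cD A N P by (auto simp: M_def)
  have cM: "M \<in> carrier_mat (2 * n) (2 * n)" by (auto intro!: carrier_matI)
  have Mt: "M\<^sup>T = - M" using D cD unfolding M_def by (simp add: skew_hamiltonian_iff)
  have "M * A = 0\<^sub>m (2 * n) k"
    unfolding M_def by (simp add: mult_mat_assoc_dims DA)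
  then have "M * (A * N) = 0\<^sub>m (2 * n) (2 * n)"
    using N by (simp add: mult_mat_assoc_dims[symmetric])
  moreover have "M * (A * N + P * P\<^sup>T) = M * (A * N) + M * (P * P\<^sup>T)"
    by (rule mult_add_distrib_mat[OF cM]) (auto intro!: carrier_matI)
  moreover have "M * (P * P\<^sup>T) \<in> carrier_mat (2 * n) (2 * n)" by (auto intro!: carrier_matI)
  ultimately have MP: "M * (P * P\<^sup>T) = M"
    using cM by (simp add: one)
  \<comment> \<open>Transposing \<open>MP\<close> and using that \<open>M\<close> is skew moves the
    factor \<open>P * P\<^sup>T\<close> to the left of \<open>M\<close>.\<close>
  have "P * (P\<^sup>T * M\<^sup>T) = (M * (P * P\<^sup>T))\<^sup>T"
    by (simp add: transpose_mult_dims mult_mat_assoc_dims)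
  then have PM: "P * (P\<^sup>T * M) = M" unfolding MP Mt by simp
  \<comment> \<open>The witness is the compression of \<open>M\<close> to the columns of
    \<open>P\<close>; \<open>MP\<close> and \<open>PM\<close> show that \<open>M\<close> is
    recovered from it.\<close>
  define S where "S = P\<^sup>T * M * P"
  have "skew_symmetric m S"
    unfolding skew_symmetric_def S_def
    by (auto intro!: carrier_matI simp: transpose_mult_dims mult_mat_assoc_dims Mt)
  moreover have "P * S * P\<^sup>T = M"
  proof -
    have "P * S * P\<^sup>T = P * (P\<^sup>T * (M * (P * P\<^sup>T)))"
      unfolding S_def by (simp add: mult_mat_assoc_dims)
    then show ?thesis by (simp add: MP PM)
  qed
  then have "(J_mat n)\<^sup>T * (P * S * P\<^sup>T) = D"
    by (simp add: M_def transpose_J_mat J_mat_mult_J_mat_mult)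
  then have "D = (J_mat n)\<^sup>T * P * S * P\<^sup>T"
    by (simp add: S_def mult_mat_assoc_dims)
  ultimately show thesis by (rule that)
qed

section \<open>The matrices X_L and X_R\<close>

lemma X_left_carrier: "length xs = n \<Longrightarrow> X_left n xs \<in> carrier_mat (2 * n) (n - 1)"
  and X_right_carrier: "length xs = n \<Longrightarrow> X_right n xs \<in> carrier_mat (2 * n) (n - 1)"
  unfolding X_left_def X_right_def by auto

lemma col_X_left:
  "length xs = n \<Longrightarrow> set xs \<subseteq> carrier_vec (2 * n) \<Longrightarrow> j < n - 1 \<Longrightarrow> col (X_left n xs) j = xs ! j"
  and col_X_right:
  "length xs = n \<Longrightarrow> set xs \<subseteq> carrier_vec (2 * n) \<Longrightarrow> j < n - 1 \<Longrightarrow> col (X_right n xs) j = xs ! (j + 1)"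
  unfolding X_left_def X_right_def by (auto simp: nth_butlast nth_tl subset_iff)

text \<open>Column \<open>k\<close> of X_R is the successor of column \<open>k\<close> of X_L, so
  comparing columns turns the chain condition into one matrix equation.\<close>

lemma mult_X_left_eq_iff:
  assumes xs: "length xs = n" "set xs \<subseteq> carrier_vec (2 * n)"
    and H: "H \<in> carrier_mat (2 * n) (2 * n)"
  shows "H * X_left n xs = X_right n xs \<longleftrightarrow> (\<forall>k < n - 1. H *\<^sub>v (xs ! k) = xs ! (k + 1))"
proof -
  note XL = X_left_carrier[OF xs(1)] and XR = X_right_carrier[OF xs(1)]
  have "H * X_left n xs = X_right n xs \<longleftrightarrow>
      (\<forall>k < n - 1. col (H * X_left n xs) k = col (X_right n xs) k)"
    using XL XR H by (metis mat_col_eqI carrier_matD mult_carrier_mat)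
  also have "\<dots> \<longleftrightarrow> (\<forall>k < n - 1. H *\<^sub>v (xs ! k) = xs ! (k + 1))"
    by (simp add: col_mult2[OF H XL] col_X_left[OF xs] col_X_right[OF xs] del: One_nat_def)
  finally show ?thesis .
qed

text \<open>Each entry pairs two basis vectors under the form of J. Its vanishing makes the second
  summand of \<open>H_hat n xs\<close> annihilate X_L.\<close>

lemma isotropic_X_right_X_left:
  assumes L: "isotropic n L" and xs: "length xs = n" "set xs \<subseteq> L"
  shows "(X_right n xs)\<^sup>T * (J_mat n * X_left n xs) = 0\<^sub>m (n - 1) (n - 1)"
proof -
  note XL = X_left_carrier[OF xs(1)] and XR = X_right_carrier[OF xs(1)]
  have c: "set xs \<subseteq> carrier_vec (2 * n)"
    using L xs rsubspace_vectorspace(2)[of "2 * n" L] unfolding isotropic_def by auto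
  have L': "x \<bullet> (J_mat n *\<^sub>v y) = 0" if "x \<in> set xs" "y \<in> set xs" for x y
    using L xs that unfolding isotropic_def by auto
  show ?thesis
    using XL XR
    by (intro eq_matI)
      (auto simp: col_mult2[OF J_mat_carrier XL] col_X_left[OF xs(1) c] col_X_right[OF xs(1) c]
        xs(1) intro!: L')
qed

section \<open>Parametrization of the solution set\<close>

theorem theorem2:
  fixes n :: nat and L :: "real vec set" and xs :: "real vec list"
    and Xperp H :: "real mat"
  assumes "n \<ge> 1"
    and "lagrangian n L"
    and "length xs = n"
    and "ordered_basis (2 * n) L xs"
    and "Xperp \<in> carrier_mat (2 * n) (n + 1)"
    and "orthonormal (cols Xperp)"
    and "ordered_basis (2 * n) (orth_compl (2 * n) (rspan (2 * n) (set (butlast xs)))) (cols Xperp)"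
    and "H \<in> carrier_mat (2 * n) (2 * n)"
  shows "H \<in> HK n xs \<longleftrightarrow>
    (\<exists>S. skew_symmetric (n + 1) S \<and>
         H = H_hat n xs + transpose_mat (J_mat n) * Xperp * S * transpose_mat Xperp)"
proof -
  let ?J = "J_mat n" and ?A = "X_left n xs" and ?R = "X_right n xs" and ?P = Xperp
  have iso: "isotropic n L" and sub: "rsubspace (2 * n) L"
    using assms(2) unfolding lagrangian_def isotropic_def by auto
  have xsL: "set xs \<subseteq> L" by (rule ordered_basis_subset[OF sub assms(4)])
  then have xs: "set xs \<subseteq> carrier_vec (2 * n)" using rsubspace_vectorspace(2)[OF sub] by auto
  have but: "set (butlast xs) \<subseteq> carrier_vec (2 * n)" using xs by (auto dest: in_set_butlastD)
  note A = X_left_carrier[OF assms(3)] and R = X_right_carrier[OF assms(3)] and P = assms(5)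
  have dims [simp]: "dim_row ?A = 2 * n" "dim_col ?A = n - 1" "dim_row ?R = 2 * n"
    "dim_col ?R = n - 1" "dim_row ?P = 2 * n" "dim_col ?P = n + 1"
    "dim_row H = 2 * n" "dim_col H = 2 * n"
    using A R P assms(8) by auto
  have PP: "?P\<^sup>T * ?P = 1\<^sub>m (n + 1)"
    using assms(6) P by (intro eq_matI) (auto simp: orthonormal_def)
  \<comment> \<open>Members of a basis of the complement lie in it, hence are orthogonal to each
    generator.\<close>
  have orth: "x \<bullet> y = 0" if "x \<in> set (cols ?P)" "y \<in> set (butlast xs)" for x y
    using ordered_basis_subset[OF rsubspace_orth_compl[OF orth_compl_rspan(2)[OF but]] assms(7)]
      that orth_compl_rspan(1)[OF but] by auto
  have PA: "?P\<^sup>T * ?A = 0\<^sub>m (n + 1) (n - 1)"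
  proof (intro eq_matI)
    fix i j assume "i < dim_row (0\<^sub>m (n + 1) (n - 1) :: real mat)"
      "j < dim_col (0\<^sub>m (n + 1) (n - 1) :: real mat)"
    then have ij: "i < n + 1" "j < n - 1" by auto
    have "col ?P i \<in> set (cols ?P)"
      using ij cols_nth[of i ?P] nth_mem[of i "cols ?P"] by simp
    moreover have "xs ! j \<in> set (butlast xs)"
      using ij assms(3) by (auto simp: in_set_conv_nth nth_butlast)
    ultimately show "(?P\<^sup>T * ?A) $$ (i, j) = 0\<^sub>m (n + 1) (n - 1) $$ (i, j)"
      using ij orth by (simp add: col_X_left[OF assms(3) xs])
  qed auto
  have AP: "?A\<^sup>T * ?P = 0\<^sub>m (n - 1) (n + 1)"
    using arg_cong[OF PA, of transpose_mat] by (simp add: transpose_mult_dims)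
  \<comment> \<open>Dropping the last basis vector preserves independence.\<close>
  have inj: "v = 0\<^sub>v (n - 1)" if "v \<in> carrier_vec (n - 1)" "?A *\<^sub>v v = 0\<^sub>v (2 * n)" for v
    using ordered_basis_mult_vec_eq_0[OF sub assms(4), of "butlast xs" v] that assms(3,4)
    by (auto simp: X_left_def ordered_basis_def distinct_butlast dest: in_set_butlastD)
  obtain G where G: "G \<in> carrier_mat (n - 1) (n - 1)" and N_eq: "pinv ?A = G * ?A\<^sup>T"
    and NA: "pinv ?A * ?A = 1\<^sub>m (n - 1)"
    using pinv_full_column_rank[OF A inj] by metis
  define N where "N = pinv ?A"
  have N: "N \<in> carrier_mat (n - 1) (2 * n)" using G A unfolding N_def N_eq by auto
  then have dN [simp]: "dim_row N = n - 1" "dim_col N = 2 * n" by auto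
  have NP: "N * ?P = 0\<^sub>m (n - 1) (n + 1)"
    using G unfolding N_def N_eq by (simp add: mult_mat_assoc_dims AP)
  \<comment> \<open>The two column counts fill the whole space; \<open>n \<ge> 1\<close> enters
    through the truncated subtraction. For \<open>n = 1\<close> the first block is empty.\<close>
  have n2: "n - 1 + (n + 1) = 2 * n" using assms(1) by simp
  \<comment> \<open>The summands are the orthogonal projections onto the span of the first n - 1
    basis vectors and onto its complement.\<close>
  have one: "?A * N + ?P * ?P\<^sup>T = 1\<^sub>m (2 * n)"
    using sum_complementary_products_eq_one[of ?A "n - 1" "n + 1" ?P N "?P\<^sup>T"]
      A P N NA NP PA PP unfolding n2 N_def by simp
  define K where "K = ?R * N"
  have K: "K \<in> carrier_mat (2 * n) (2 * n)" unfolding K_def using R N by simp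
  have hat: "H_hat n xs = K + ?J\<^sup>T * K\<^sup>T * ?J" unfolding H_hat_def K_def N_def ..
  have c_hat: "H_hat n xs \<in> carrier_mat (2 * n) (2 * n)"
    unfolding hat using K by auto
  have hat_skew: "skew_hamiltonian n (H_hat n xs)"
    unfolding hat by (rule skew_hamiltonian_symmetrization[OF K])
  \<comment> \<open>Regrouping exposes the product that vanishes by isotropy.\<close>
  have "?J\<^sup>T * K\<^sup>T * ?J * ?A = ?J\<^sup>T * (N\<^sup>T * (?R\<^sup>T * (?J * ?A)))"
    by (simp add: K_def transpose_mult_dims mult_mat_assoc_dims)
  also have "\<dots> = 0\<^sub>m (2 * n) (n - 1)"
    using N by (simp add: isotropic_X_right_X_left[OF iso assms(3) xsL] transpose_J_mat)
  finally have JKA: "?J\<^sup>T * K\<^sup>T * ?J * ?A = 0\<^sub>m (2 * n) (n - 1)" .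
  have "H_hat n xs * ?A = K * ?A + ?J\<^sup>T * K\<^sup>T * ?J * ?A"
    unfolding hat using K A by (intro add_mult_distrib_mat) auto
  also have "K * ?A = ?R"
    using NA R by (simp add: K_def N_def[symmetric] mult_mat_assoc_dims)
  finally have hat_A: "H_hat n xs * ?A = ?R" using R by (simp add: JKA)
  have HK_iff: "H \<in> HK n xs \<longleftrightarrow> skew_hamiltonian n H \<and> H * ?A = ?R"
    unfolding HK_def using mult_X_left_eq_iff[OF assms(3) xs assms(8)] by simp
  show ?thesis
  proof
    assume "H \<in> HK n xs"
    then have H: "skew_hamiltonian n H" "H * ?A = ?R" unfolding HK_iff by auto
    \<comment> \<open>Both matrices map X_L to X_R, so their difference annihilates X_L and remains
      skew-Hamiltonian.\<close>
    let ?D = "H + - H_hat n xs"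
    have "skew_hamiltonian n ?D"
      by (intro skew_hamiltonian_add skew_hamiltonian_uminus H hat_skew)
    moreover have "?D * ?A = H * ?A + - H_hat n xs * ?A"
      using c_hat assms(8) A by (intro add_mult_distrib_mat) auto
    then have "?D * ?A = 0\<^sub>m (2 * n) (n - 1)"
      using c_hat R by (simp add: H hat_A comm_add_mat[of ?R "2 * n" "n - 1"])
    ultimately obtain S where "skew_symmetric (n + 1) S" "?D = ?J\<^sup>T * ?P * S * ?P\<^sup>T"
      using skew_hamiltonian_annihilating[OF _ A N P one] by blast
    moreover have "H = H_hat n xs + ?D"
      using c_hat assms(8) by (intro eq_matI) auto
    ultimately show "\<exists>S. skew_symmetric (n + 1) S \<and> H = H_hat n xs + ?J\<^sup>T * ?P * S * ?P\<^sup>T"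
      by metis
  next
    assume "\<exists>S. skew_symmetric (n + 1) S \<and> H = H_hat n xs + ?J\<^sup>T * ?P * S * ?P\<^sup>T"
    then obtain S where S: "skew_symmetric (n + 1) S"
      and H: "H = H_hat n xs + ?J\<^sup>T * ?P * S * ?P\<^sup>T" by blast
    have cS: "S \<in> carrier_mat (n + 1) (n + 1)" using S unfolding skew_symmetric_def by simp
    then have dS [simp]: "dim_row S = n + 1" "dim_col S = n + 1" by auto
    have "H * ?A = H_hat n xs * ?A + ?J\<^sup>T * ?P * S * ?P\<^sup>T * ?A"
      unfolding H using c_hat A P cS by (intro add_mult_distrib_mat) auto
    \<comment> \<open>By \<open>PA\<close> the correction term does not act on X_L, whatever
      \<open>S\<close> is.\<close>
    also have "?J\<^sup>T * ?P * S * ?P\<^sup>T * ?A = 0\<^sub>m (2 * n) (n - 1)"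
      using P cS by (simp add: mult_mat_assoc_dims PA)
    finally have "H * ?A = ?R" using R by (simp add: hat_A)
    moreover have "skew_hamiltonian n H"
      unfolding H by (intro skew_hamiltonian_add hat_skew skew_hamiltonian_J_mat_sandwich[OF P S])
    ultimately show "H \<in> HK n xs" unfolding HK_iff by simp
  qed
qed

end
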